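(* Fix a finite set $X$ and a Yang--Baxter solution $R:X^2\to X^2$ on $X$. Fix $k\ge2$. Let $\Lambda_{k,R}^0=\{v\}$. For $i\le k$, let $\Lambda_{k,R}^{\varepsilon_i}=\{i\}\times X$. For $(i,e)\in\Lambda_{k,R}^{\varepsilon_i}$ and $(j,f)\in\Lambda_{k,R}^{\varepsilon_j}$ with $i<j$, set $$(i,e)(j,f)=(j,f')(i,e')\quad\text{if } R(e,f)=(f',e').$$ There is a unique $k$-graph $\Lambda_{k,R}$ with these edges and factorisation rules. If $R$ is a permutation-type Yang--Baxter solution, then $i:\Lambda_{k,R}\to\Pi(\Lambda_{k,R})$ is injective.
   Context: A $k$-graph is a small category $\Lambda$ (identified with its set of morphisms) with a functor $d:\Lambda\to\mathbb{N}^k$ satisfying the factorisation property: if $d(\lambda)=m+n$ there are unique $\mu,\nu\in\Lambda$ with $d(\mu)=m$, $d(\nu)=n$, $\lambda=\mu\nu$. $\Lambda^n=d^{-1}(n)$; $\Lambda^0$ is the set of identity morphisms (vertices); $\varepsilon_1,\dots,\varepsilon_k$ are the standard generators of $\mathbb{N}^k$, and elements of $\bigcup_i\Lambda^{\varepsilon_i}$ are called edges. Let $X$ be a nonempty set. A map $R:X^2\to X^2$ is a (set-theoretic) Yang--Baxter solution if $(R\times\mathrm{id}_X)(\mathrm{id}_X\times R)(R\times\mathrm{id}_X)=(\mathrm{id}_X\times R)(R\times\mathrm{id}_X)(\mathrm{id}_X\times R)$ as maps on $X^3$. For every permutation $\sigma$ of $X$ there is a Yang--Baxter solution $R$ given by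 $R(e,f)=(\sigma(f),e)$; such solutions are called permutation-type Yang--Baxter solutions. The fundamental groupoid of a $k$-graph $\Lambda$ is a groupoid $\Pi(\Lambda)$ with a functor $i:\Lambda\to\Pi(\Lambda)$, $i(\Lambda^0)=\Pi(\Lambda)^0$, such that for every functor $F$ from $\Lambda$ to a groupoid $\mathcal G$ there is a unique groupoid homomorphism $\tilde F:\Pi(\Lambda)\to\mathcal G$ with $\tilde F\circ i=F$.
   Formalization: Existence of the k-graph is claimed only for bijective R; for a non-bijective solution (e.g. a constant map with |X| ≥ 2) the factorisation rules contradict unique factorisation, so no such k-graph exists. *)

theory Defs
  imports "HOL-Library.FuncSet" "HOL-Library.Function_Algebras"
begin

section \<open>Small categories and groupoids\<close>

text \<open>
  A small category is identified with its set of morphisms: objects are the identity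
  morphisms, so source and range are maps from morphisms to morphisms.  The product
  \<open>a \<cdot> b\<close> is meaningful only when the source of \<open>a\<close> is the range of \<open>b\<close>.
\<close>

record 'a category =
  arr :: "'a set"
  src :: "'a \<Rightarrow> 'a"
  rng :: "'a \<Rightarrow> 'a"
  comp :: "'a \<Rightarrow> 'a \<Rightarrow> 'a"  (infixl "\<cdot>\<index>" 70)

definition obj :: "('a, 'm) category_scheme \<Rightarrow> 'a set" where
  "obj C = {v \<in> arr C. src C v = v \<and> rng C v = v}"

locale small_category =
  fixes C :: "('a, 'm) category_scheme" (structure)
  assumes src_obj: "a \<in> arr C \<Longrightarrow> src C a \<in> obj C"
    and rng_obj: "a \<in> arr C \<Longrightarrow> rng C a \<in> obj C"
    and comp_arr: "\<lbrakk>a \<in> arr C; b \<in> arr C; src C a = rng C b\<rbrakk> \<Longrightarrow> a \<cdot> b \<in> arr C"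
    and src_comp: "\<lbrakk>a \<in> arr C; b \<in> arr C; src C a = rng C b\<rbrakk> \<Longrightarrow> src C (a \<cdot> b) = src C b"
    and rng_comp: "\<lbrakk>a \<in> arr C; b \<in> arr C; src C a = rng C b\<rbrakk> \<Longrightarrow> rng C (a \<cdot> b) = rng C a"
    and id_left: "a \<in> arr C \<Longrightarrow> rng C a \<cdot> a = a"
    and id_right: "a \<in> arr C \<Longrightarrow> a \<cdot> src C a = a"
    and assoc: "\<lbrakk>a \<in> arr C; b \<in> arr C; c \<in> arr C; src C a = rng C b; src C b = rng C c\<rbrakk>
      \<Longrightarrow> (a \<cdot> b) \<cdot> c = a \<cdot> (b \<cdot> c)"

locale groupoid = small_category C for C :: "('a, 'm) category_scheme" (structure) +
  assumes invertible: "a \<in> arr C \<Longrightarrow>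
    \<exists>b \<in> arr C. src C b = rng C a \<and> rng C b = src C a \<and> a \<cdot> b = rng C a \<and> b \<cdot> a = src C a"

text \<open>Preservation of identities is the case of an identity morphism in the source and range laws.\<close>

definition is_functor ::
    "('a, 'm) category_scheme \<Rightarrow> ('b, 'n) category_scheme \<Rightarrow> ('a \<Rightarrow> 'b) \<Rightarrow> bool" where
  "is_functor C D F \<longleftrightarrow>
     (\<forall>a \<in> arr C. F a \<in> arr D \<and> src D (F a) = F (src C a) \<and> rng D (F a) = F (rng C a)) \<and>
     (\<forall>a \<in> arr C. \<forall>b \<in> arr C. src C a = rng C b \<longrightarrow> F (a \<cdot>\<^bsub>C\<^esub> b) = F a \<cdot>\<^bsub>D\<^esub> F b)"

section \<open>Higher-rank graphs\<close>

text \<open>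
  Elements of \<open>\<nat>\<^sup>k\<close> are functions on the naturals that vanish outside \<open>{1..k}\<close>, added pointwise.
\<close>

definition Nk :: "nat \<Rightarrow> (nat \<Rightarrow> nat) set" where
  "Nk k = {n. \<forall>i. i \<notin> {1..k} \<longrightarrow> n i = 0}"

definition gen :: "nat \<Rightarrow> nat \<Rightarrow> nat" where
  "gen i = (\<lambda>j. if j = i then 1 else 0)"

record 'a kgraph = "'a category" +
  deg :: "'a \<Rightarrow> nat \<Rightarrow> nat"

locale k_graph = small_category \<Lambda>
  for k :: nat and \<Lambda> :: "('a, 'm) kgraph_scheme" (structure) +
  assumes deg_Nk: "a \<in> arr \<Lambda> \<Longrightarrow> deg \<Lambda> a \<in> Nk k"
    and deg_obj: "v \<in> obj \<Lambda> \<Longrightarrow> deg \<Lambda> v = 0"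
    and deg_comp: "\<lbrakk>a \<in> arr \<Lambda>; b \<in> arr \<Lambda>; src \<Lambda> a = rng \<Lambda> b\<rbrakk>
      \<Longrightarrow> deg \<Lambda> (a \<cdot> b) = deg \<Lambda> a + deg \<Lambda> b"
    and factorisation: "\<lbrakk>a \<in> arr \<Lambda>; m \<in> Nk k; n \<in> Nk k; deg \<Lambda> a = m + n\<rbrakk>
      \<Longrightarrow> \<exists>!(b, c). b \<in> arr \<Lambda> \<and> c \<in> arr \<Lambda> \<and> src \<Lambda> b = rng \<Lambda> c \<and>
            deg \<Lambda> b = m \<and> deg \<Lambda> c = n \<and> a = b \<cdot> c"

definition of_deg :: "('a, 'm) kgraph_scheme \<Rightarrow> (nat \<Rightarrow> nat) \<Rightarrow> 'a set" where
  "of_deg \<Lambda> n = {a \<in> arr \<Lambda>. deg \<Lambda> a = n}"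

definition kgraph_iso ::
    "('a, 'm) kgraph_scheme \<Rightarrow> ('b, 'n) kgraph_scheme \<Rightarrow> ('a \<Rightarrow> 'b) \<Rightarrow> bool" where
  "kgraph_iso \<Lambda> \<Lambda>' \<phi> \<longleftrightarrow> is_functor \<Lambda> \<Lambda>' \<phi> \<and> bij_betw \<phi> (arr \<Lambda>) (arr \<Lambda>') \<and>
     (\<forall>a \<in> arr \<Lambda>. deg \<Lambda>' (\<phi> a) = deg \<Lambda> a)"

section \<open>Yang--Baxter solutions and their higher-rank graphs\<close>

text \<open>The maps \<open>R \<times> id\<close> and \<open>id \<times> R\<close> on triples.\<close>

definition R12 :: "('x \<times> 'x \<Rightarrow> 'x \<times> 'x) \<Rightarrow> 'x \<times> 'x \<times> 'x \<Rightarrow> 'x \<times> 'x \<times> 'x" where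
  "R12 R = (\<lambda>(x, y, z). let (x', y') = R (x, y) in (x', y', z))"

definition R23 :: "('x \<times> 'x \<Rightarrow> 'x \<times> 'x) \<Rightarrow> 'x \<times> 'x \<times> 'x \<Rightarrow> 'x \<times> 'x \<times> 'x" where
  "R23 R = (\<lambda>(x, y, z). let (y', z') = R (y, z) in (x, y', z'))"

definition yang_baxter :: "'x set \<Rightarrow> ('x \<times> 'x \<Rightarrow> 'x \<times> 'x) \<Rightarrow> bool" where
  "yang_baxter X R \<longleftrightarrow> R \<in> X \<times> X \<rightarrow> X \<times> X \<and>
     (\<forall>t \<in> X \<times> X \<times> X. (R12 R \<circ> R23 R \<circ> R12 R) t = (R23 R \<circ> R12 R \<circ> R23 R) t)"

definition permutation_type :: "'x set \<Rightarrow> ('x \<times> 'x \<Rightarrow> 'x \<times> 'x) \<Rightarrow> bool" where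
  "permutation_type X R \<longleftrightarrow>
     (\<exists>\<sigma>. bij_betw \<sigma> X X \<and> (\<forall>e \<in> X. \<forall>f \<in> X. R (e, f) = (\<sigma> f, e)))"

text \<open>
  \<open>\<Lambda>\<close> is a \<open>k\<close>-graph \<open>\<Lambda>\<^bsub>k,R\<^esub>\<close>.  The labelling \<open>\<eta>\<close> identifies \<open>{i} \<times> X\<close> with the set of
  morphisms of degree \<open>gen i\<close>; it is only relevant on \<open>{1..k} \<times> X\<close>.
\<close>

definition yb_kgraph ::
    "nat \<Rightarrow> 'x set \<Rightarrow> ('x \<times> 'x \<Rightarrow> 'x \<times> 'x) \<Rightarrow> 'a kgraph \<Rightarrow> (nat \<times> 'x \<Rightarrow> 'a) \<Rightarrow> bool" where
  "yb_kgraph k X R \<Lambda> \<eta> \<longleftrightarrow>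
     k_graph k \<Lambda> \<and>
     (\<exists>v. of_deg \<Lambda> 0 = {v}) \<and>
     (\<forall>i \<in> {1..k}. bij_betw \<eta> ({i} \<times> X) (of_deg \<Lambda> (gen i))) \<and>
     (\<forall>i \<in> {1..k}. \<forall>j \<in> {1..k}. \<forall>e \<in> X. \<forall>f \<in> X. \<forall>e' f'.
        i < j \<and> R (e, f) = (f', e') \<longrightarrow>
        \<eta> (i, e) \<cdot>\<^bsub>\<Lambda>\<^esub> \<eta> (j, f) = \<eta> (j, f') \<cdot>\<^bsub>\<Lambda>\<^esub> \<eta> (i, e'))"

section \<open>The fundamental groupoid\<close>

text \<open>
  A definition cannot quantify over types, so the groupoids \<open>G\<close> in the universal property of
  \<open>(P, \<iota>)\<close> range over one type, large enough to contain a copy of every groupoid generated by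
  an image of the category \<open>C\<close> or of \<open>P\<close>: its elements are words in morphisms of \<open>C\<close> and \<open>P\<close>
  and their formal inverses.  Nothing is lost: \<open>fundamental_groupoid_universal\<close> below
  gives the universal property for groupoids of every type.
\<close>

definition fundamental_groupoid ::
    "('a, 'm) category_scheme \<Rightarrow> 'p category \<Rightarrow> ('a \<Rightarrow> 'p) \<Rightarrow> bool" where
  "fundamental_groupoid C P \<iota> \<longleftrightarrow>
     groupoid P \<and> is_functor C P \<iota> \<and> \<iota> ` obj C = obj P \<and>
     (\<forall>(G :: (('a + 'p) \<times> bool) list category) F. groupoid G \<and> is_functor C G F \<longrightarrow>
        (\<exists>!H. H \<in> extensional (arr P) \<and> is_functor P G H \<and> (\<forall>a \<in> arr C. H (\<iota> a) = F a)))"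

context groupoid
begin

definition inverse :: "'a \<Rightarrow> 'a" where
  "inverse a = (SOME b. b \<in> arr C \<and> src C b = rng C a \<and> rng C b = src C a \<and>
     a \<cdot> b = rng C a \<and> b \<cdot> a = src C a)"

lemma inverse:
  assumes "a \<in> arr C"
  shows "inverse a \<in> arr C" "src C (inverse a) = rng C a" "rng C (inverse a) = src C a"
    "a \<cdot> inverse a = rng C a" "inverse a \<cdot> a = src C a"
proof -
  have "\<exists>b. b \<in> arr C \<and> src C b = rng C a \<and> rng C b = src C a \<and>
     a \<cdot> b = rng C a \<and> b \<cdot> a = src C a"
    using invertible[OF assms] by blast
  from someI_ex[OF this, folded inverse_def]
  show "inverse a \<in> arr C" "src C (inverse a) = rng C a" "rng C (inverse a) = src C a"
    "a \<cdot> inverse a = rng C a" "inverse a \<cdot> a = src C a" by auto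
qed

definition letter :: "('b \<Rightarrow> 'a) \<Rightarrow> 'b \<times> bool \<Rightarrow> 'a" where
  "letter g x = (if snd x then g (fst x) else inverse (g (fst x)))"

inductive_set span :: "'b set \<Rightarrow> ('b \<Rightarrow> 'a) \<Rightarrow> 'a set" for B g where
  single: "fst x \<in> B \<Longrightarrow> letter g x \<in> span B g"
| step: "\<lbrakk>fst x \<in> B; s \<in> span B g; src C (letter g x) = rng C s\<rbrakk>
    \<Longrightarrow> letter g x \<cdot> s \<in> span B g"

fun word :: "('b \<Rightarrow> 'a) \<Rightarrow> ('b \<times> bool) list \<Rightarrow> 'a" where
  "word g [] = undefined"
| "word g [x] = letter g x"
| "word g (x # y # w) = letter g x \<cdot> word g (y # w)"

lemma word_Cons: "w \<noteq> [] \<Longrightarrow> word g (x # w) = letter g x \<cdot> word g w"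
  by (cases w) simp_all

lemma span_word: "s \<in> span B g \<Longrightarrow> \<exists>w. w \<noteq> [] \<and> s = word g w"
proof (induction rule: span.induct)
  case (single x)
  have "[x] \<noteq> [] \<and> letter g x = word g [x]" by simp
  then show ?case by (rule exI)
next
  case (step x s)
  then obtain w where "w \<noteq> []" "s = word g w" by (elim exE conjE)
  then have "x # w \<noteq> [] \<and> letter g x \<cdot> s = word g (x # w)" by (simp add: word_Cons)
  then show ?case by (rule exI)
qed

lemma letter_arr: "g \<in> B \<rightarrow> arr C \<Longrightarrow> fst x \<in> B \<Longrightarrow> letter g x \<in> arr C"
  by (simp add: letter_def inverse funcset_mem[of g B])

lemma span_arr:
  assumes "g \<in> B \<rightarrow> arr C" "s \<in> span B g"
  shows "s \<in> arr C"
  using assms(2) by induction (simp_all add: comp_arr letter_arr[OF assms(1)] del: split_paired_all)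

lemma span_comp:
  assumes g: "g \<in> B \<rightarrow> arr C" and s: "s \<in> span B g" and t: "t \<in> span B g"
    and "src C s = rng C t"
  shows "s \<cdot> t \<in> span B g"
  using s \<open>src C s = rng C t\<close>
proof induction
  case (single x)
  then show ?case using t by (intro span.step)
next
  case (step x s)
  note arrs = letter_arr[OF g step(1)] span_arr[OF g step(2)] span_arr[OF g t]
  have eq: "src C s = rng C t"
    using step.prems src_comp[OF arrs(1,2) step.hyps(3)] by simp
  have "letter g x \<cdot> (s \<cdot> t) \<in> span B g"
    using step.hyps(1,3) step.IH[OF eq] rng_comp[OF arrs(2,3) eq] by (intro span.step) simp_all
  then show ?case using assoc[OF arrs step.hyps(3) eq] by simp
qed

lemma inverse_unique:
  assumes a: "a \<in> arr C" and b: "b \<in> arr C" and "src C a = rng C b" "a \<cdot> b = rng C a"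
  shows "b = inverse a"
proof -
  note i = inverse[OF a]
  have "b = (inverse a \<cdot> a) \<cdot> b" using assms i id_left[OF b] by simp
  also have "\<dots> = inverse a \<cdot> (a \<cdot> b)" using assms i by (intro assoc) auto
  also have "\<dots> = inverse a" using assms i id_right[OF i(1)] by simp
  finally show ?thesis .
qed

lemma rng_of_obj: "v \<in> obj C \<Longrightarrow> rng C v = v \<and> src C v = v \<and> v \<in> arr C"
  by (simp add: obj_def)

lemma inverse_inverse: "a \<in> arr C \<Longrightarrow> inverse (inverse a) = a"
  using inverse_unique[of "inverse a" a] by (simp add: inverse)

lemma inverse_comp:
  assumes a: "a \<in> arr C" and b: "b \<in> arr C" and e: "src C a = rng C b"
  shows "inverse (a \<cdot> b) = inverse b \<cdot> inverse a"
proof -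
  note ia = inverse[OF a] and ib = inverse[OF b]
  have ba: "inverse b \<cdot> inverse a \<in> arr C" using ia ib e by (intro comp_arr) auto
  have "(a \<cdot> b) \<cdot> (inverse b \<cdot> inverse a) = a \<cdot> (b \<cdot> (inverse b \<cdot> inverse a))"
    using a b e ia ib ba by (intro assoc) (auto simp: rng_comp)
  also have "b \<cdot> (inverse b \<cdot> inverse a) = (b \<cdot> inverse b) \<cdot> inverse a"
    using a b e ia ib by (intro assoc[symmetric]) auto
  also have "\<dots> = inverse a" using ia ib e id_left[OF ia(1)] by simp
  finally have "(a \<cdot> b) \<cdot> (inverse b \<cdot> inverse a) = rng C (a \<cdot> b)"
    using ia a b e by (simp add: rng_comp)
  then show ?thesis
    using inverse_unique[of "a \<cdot> b" "inverse b \<cdot> inverse a"] a b e ia ib ba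
    by (simp add: comp_arr src_comp rng_comp)
qed

lemma span_inverse:
  assumes g: "g \<in> B \<rightarrow> arr C" and s: "s \<in> span B g"
  shows "inverse s \<in> span B g"
  using s
proof induction
  case (single x)
  have "inverse (letter g x) = letter g (fst x, \<not> snd x)"
    using single by (simp add: letter_def inverse_inverse funcset_mem[OF g])
  then show ?case using single span.single[of "(fst x, \<not> snd x)" B g] by simp
next
  case (step x s)
  note arrs = letter_arr[OF g step(1)] span_arr[OF g step(2)]
  have "inverse (letter g x) = letter g (fst x, \<not> snd x)"
    using step by (simp add: letter_def inverse_inverse funcset_mem[OF g])
  then have "inverse (letter g x) \<in> span B g"
    using step span.single[of "(fst x, \<not> snd x)" B g] by simp
  then have "inverse s \<cdot> inverse (letter g x) \<in> span B g"
    using step(3,4) arrs inverse(2)[OF arrs(2)] inverse(3)[OF arrs(1)]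
    by (intro span_comp[OF g]) simp_all
  then show ?case using inverse_comp[OF arrs step(3)] by simp
qed

lemma span_src_rng:
  assumes g: "g \<in> B \<rightarrow> arr C" and s: "s \<in> span B g"
  shows "src C s \<in> span B g" "rng C s \<in> span B g"
proof -
  note i = inverse[OF span_arr[OF assms]]
  show "src C s \<in> span B g"
    using span_comp[OF g span_inverse[OF g s] s] i by simp
  show "rng C s \<in> span B g"
    using span_comp[OF g s span_inverse[OF g s]] i by simp
qed

text \<open>
  The subgroupoid generated by \<open>g ` B\<close> is isomorphic to a groupoid with morphisms in any type
  that has room for the words over \<open>B\<close>.
\<close>

lemma span_copy:
  fixes g :: "'b \<Rightarrow> 'a" and h :: "('b \<times> bool) list \<Rightarrow> 'c"
  assumes g: "g \<in> B \<rightarrow> arr C" and h: "inj h"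
  obtains D :: "'c category" and q :: "'c \<Rightarrow> 'a" and p :: "'a \<Rightarrow> 'c" where
    "groupoid D" "is_functor D C q" "\<forall>b \<in> B. g b \<in> q ` arr D"
    "\<forall>a \<in> q ` arr D. p a \<in> arr D \<and> q (p a) = a"
    "\<forall>a \<in> q ` arr D. src C a \<in> q ` arr D \<and> rng C a \<in> q ` arr D \<and>
        src D (p a) = p (src C a) \<and> rng D (p a) = p (rng C a)"
    "\<forall>a \<in> q ` arr D. \<forall>b \<in> q ` arr D. src C a = rng C b \<longrightarrow>
        a \<cdot> b \<in> q ` arr D \<and> p (a \<cdot> b) = p a \<cdot>\<^bsub>D\<^esub> p b"
proof -
  define S where "S = span B g"
  define p where "p s = h (SOME w. s = word g w)" for s
  define q where "q = inv_into S p"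
  have SA: "s \<in> arr C" if "s \<in> S" for s using that span_arr[OF g] S_def by simp
  have pinj: "inj_on p S"
  proof (rule inj_onI)
    fix s t assume st: "s \<in> S" "t \<in> S" "p s = p t"
    have "(SOME w. s = word g w) = (SOME w. t = word g w)"
      using st(3) h by (simp add: p_def inj_eq)
    moreover have "s = word g (SOME w. s = word g w)" "t = word g (SOME w. t = word g w)"
      using span_word st(1,2) unfolding S_def by (metis (mono_tags, lifting) someI_ex)+
    ultimately show "s = t" by simp
  qed
  have qp [simp]: "q (p s) = s" if "s \<in> S" for s
    using that pinj by (simp add: q_def inv_into_f_f)
  have S_src: "src C s \<in> S" and S_rng: "rng C s \<in> S" if "s \<in> S" for s
    using that span_src_rng[OF g] by (auto simp: S_def)
  have S_comp: "s \<cdot> t \<in> S" if "s \<in> S" "t \<in> S" "src C s = rng C t" for s t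
    using that span_comp[OF g] by (auto simp: S_def)
  have S_inv: "inverse s \<in> S" if "s \<in> S" for s
    using that span_inverse[OF g] by (auto simp: S_def)
  define D :: "'c category" where
    "D = \<lparr>arr = p ` S, src = (\<lambda>t. p (src C (q t))), rng = (\<lambda>t. p (rng C (q t))),
          comp = (\<lambda>s t. p (q s \<cdot> q t))\<rparr>"
  have [simp]: "p s = p t \<longleftrightarrow> s = t" if "s \<in> S" "t \<in> S" for s t
    using that pinj by (simp add: inj_on_eq_iff)
  note objs = src_obj[unfolded obj_def, simplified] rng_obj[unfolded obj_def, simplified]
  have D_obj: "p s \<in> obj D" if "s \<in> S" "src C s = s" "rng C s = s" for s
    using that by (simp add: obj_def D_def)
  have "small_category D"
  proof
    fix a assume "a \<in> arr D"
    then obtain s where s: "s \<in> S" "a = p s" by (auto simp: D_def)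
    show "src D a \<in> obj D"
      using s D_obj[of "src C s"] S_src objs SA by (simp add: D_def)
    show "rng D a \<in> obj D"
      using s D_obj[of "rng C s"] S_rng objs SA by (simp add: D_def)
    show "rng D a \<cdot>\<^bsub>D\<^esub> a = a" using s S_rng SA id_left by (simp add: D_def)
    show "a \<cdot>\<^bsub>D\<^esub> src D a = a" using s S_src SA id_right by (simp add: D_def)
  next
    fix a b assume "a \<in> arr D" "b \<in> arr D" "src D a = rng D b"
    then obtain s t where st: "s \<in> S" "a = p s" "t \<in> S" "b = p t" "src C s = rng C t"
      using S_src S_rng by (auto simp: D_def)
    note c = S_comp[OF st(1,3,5)]
    show "a \<cdot>\<^bsub>D\<^esub> b \<in> arr D" using st c by (auto simp: D_def)
    show "src D (a \<cdot>\<^bsub>D\<^esub> b) = src D b" using st c SA by (simp add: D_def src_comp)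
    show "rng D (a \<cdot>\<^bsub>D\<^esub> b) = rng D a" using st c SA by (simp add: D_def rng_comp)
  next
    fix a b d assume "a \<in> arr D" "b \<in> arr D" "d \<in> arr D" "src D a = rng D b" "src D b = rng D d"
    then obtain s t u where st: "s \<in> S" "a = p s" "t \<in> S" "b = p t" "u \<in> S" "d = p u"
      "src C s = rng C t" "src C t = rng C u"
      using S_src S_rng by (auto simp: D_def)
    show "(a \<cdot>\<^bsub>D\<^esub> b) \<cdot>\<^bsub>D\<^esub> d = a \<cdot>\<^bsub>D\<^esub> (b \<cdot>\<^bsub>D\<^esub> d)"
      using st S_comp[of s t] S_comp[of t u] SA by (simp add: D_def assoc)
  qed
  then interpret D: small_category D .
  have "groupoid D"
  proof
    fix a assume "a \<in> arr D"
    then obtain s where s: "s \<in> S" "a = p s" by (auto simp: D_def)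
    show "\<exists>b\<in>arr D. src D b = rng D a \<and> rng D b = src D a \<and>
        a \<cdot>\<^bsub>D\<^esub> b = rng D a \<and> b \<cdot>\<^bsub>D\<^esub> a = src D a"
      using s S_inv[OF s(1)] inverse[OF SA[OF s(1)]]
      by (intro bexI[of _ "p (inverse s)"]) (simp_all add: D_def)
  qed
  have qS: "q ` arr D = S" by (force simp: D_def image_image)
  show thesis
  proof (rule that)
    show "groupoid D" by fact
    show "is_functor D C q"
      unfolding is_functor_def D_def using SA S_src S_rng S_comp by auto
    show "\<forall>b \<in> B. g b \<in> q ` arr D"
    proof
      fix b assume "b \<in> B"
      then show "g b \<in> q ` arr D"
        using span.single[of "(b, True)" B g] by (simp add: qS S_def letter_def)
    qed
    show "\<forall>a \<in> q ` arr D. p a \<in> arr D \<and> q (p a) = a"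
      unfolding qS by (simp add: D_def)
    show "\<forall>a \<in> q ` arr D. src C a \<in> q ` arr D \<and> rng C a \<in> q ` arr D \<and>
        src D (p a) = p (src C a) \<and> rng D (p a) = p (rng C a)"
      using S_src S_rng unfolding qS by (simp add: D_def)
    show "\<forall>a \<in> q ` arr D. \<forall>b \<in> q ` arr D. src C a = rng C b \<longrightarrow>
        a \<cdot> b \<in> q ` arr D \<and> p (a \<cdot> b) = p a \<cdot>\<^bsub>D\<^esub> p b"
      using S_comp unfolding qS by (simp add: D_def)
  qed
qed

end

lemma is_functor_comp:
  "is_functor A B F \<Longrightarrow> is_functor B C G \<Longrightarrow> is_functor A C (\<lambda>a. G (F a))"
  by (simp add: is_functor_def)

lemma is_functor_cong:
  assumes "small_category A" "is_functor A B F" "\<And>a. a \<in> arr A \<Longrightarrow> F a = F' a"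
  shows "is_functor A B F'"
proof -
  interpret small_category A by fact
  have [simp]: "src A a \<in> arr A" "rng A a \<in> arr A" if "a \<in> arr A" for a
    using that src_obj rng_obj by (auto simp: obj_def)
  show ?thesis using assms(2,3) comp_arr by (simp add: is_functor_def)
qed

lemma is_functor_lift:
  assumes F: "is_functor A G F" "\<forall>a \<in> arr A. F a \<in> Q"
    and p: "\<forall>a \<in> Q. p a \<in> arr D \<and> q (p a) = a"
      "\<forall>a \<in> Q. src G a \<in> Q \<and> rng G a \<in> Q \<and> src D (p a) = p (src G a) \<and> rng D (p a) = p (rng G a)"
      "\<forall>a \<in> Q. \<forall>b \<in> Q. src G a = rng G b \<longrightarrow>
        a \<cdot>\<^bsub>G\<^esub> b \<in> Q \<and> p (a \<cdot>\<^bsub>G\<^esub> b) = p a \<cdot>\<^bsub>D\<^esub> p b"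
  shows "is_functor A D (\<lambda>a. p (F a))"
  unfolding is_functor_def
proof (intro conjI ballI impI)
  fix a assume a: "a \<in> arr A"
  then have FQ: "F a \<in> Q" using F(2) by blast
  have "src G (F a) = F (src A a)" "rng G (F a) = F (rng A a)"
    using F(1) a by (simp_all add: is_functor_def)
  then show "p (F a) \<in> arr D" "src D (p (F a)) = p (F (src A a))" "rng D (p (F a)) = p (F (rng A a))"
    using p(1,2) FQ by simp_all
  fix b assume b: "b \<in> arr A" and ab: "src A a = rng A b"
  then have "F b \<in> Q" using F(2) by blast
  moreover have "src G (F a) = rng G (F b)" "F (a \<cdot>\<^bsub>A\<^esub> b) = F a \<cdot>\<^bsub>G\<^esub> F b"
    using F(1) a b ab by (simp_all add: is_functor_def)
  ultimately show "p (F (a \<cdot>\<^bsub>A\<^esub> b)) = p (F a) \<cdot>\<^bsub>D\<^esub> p (F b)"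
    using p(3) FQ by simp
qed

theorem fundamental_groupoid_universal:
  fixes C :: "('a, 'm) category_scheme" and P :: "'p category" and G :: "('g, 'n) category_scheme"
  assumes C: "small_category C" and P: "fundamental_groupoid C P \<iota>"
    and G: "groupoid G" and F: "is_functor C G F"
  shows "\<exists>!H. H \<in> extensional (arr P) \<and> is_functor P G H \<and> (\<forall>a \<in> arr C. H (\<iota> a) = F a)"
proof -
  interpret C: small_category C by fact
  interpret G: groupoid G by fact
  interpret P: groupoid P using P by (simp add: fundamental_groupoid_def)
  have \<iota>: "is_functor C P \<iota>" using P by (simp add: fundamental_groupoid_def)
  have univ: "\<exists>!H. H \<in> extensional (arr P) \<and> is_functor P D H \<and> (\<forall>a \<in> arr C. H (\<iota> a) = F a)"
    if "groupoid D" "is_functor C D F" for D :: "(('a + 'p) \<times> bool) list category" and F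
    by (rule P[unfolded fundamental_groupoid_def, THEN conjunct2, THEN conjunct2, THEN conjunct2,
          rule_format, OF conjI[OF that]])

  have ex: "\<exists>H. H \<in> extensional (arr P) \<and> is_functor P G H \<and> (\<forall>a \<in> arr C. H (\<iota> a) = F a)"
  proof -
    define h :: "('a \<times> bool) list \<Rightarrow> (('a + 'p) \<times> bool) list" where "h = map (map_prod Inl id)"
    have "inj h" unfolding h_def by (intro inj_mapI prod.inj_map) auto
    have F_arr: "F \<in> arr C \<rightarrow> arr G" using F by (auto simp: is_functor_def)
    obtain D :: "(('a + 'p) \<times> bool) list category" and q p where D: "groupoid D"
      and q: "is_functor D G q" and FD: "\<forall>a \<in> arr C. F a \<in> q ` arr D"
      and p: "\<forall>a \<in> q ` arr D. p a \<in> arr D \<and> q (p a) = a"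
        "\<forall>a \<in> q ` arr D. src G a \<in> q ` arr D \<and> rng G a \<in> q ` arr D \<and>
          src D (p a) = p (src G a) \<and> rng D (p a) = p (rng G a)"
        "\<forall>a \<in> q ` arr D. \<forall>b \<in> q ` arr D. src G a = rng G b \<longrightarrow>
          a \<cdot>\<^bsub>G\<^esub> b \<in> q ` arr D \<and> p (a \<cdot>\<^bsub>G\<^esub> b) = p a \<cdot>\<^bsub>D\<^esub> p b"
      by (rule G.span_copy[OF F_arr \<open>inj h\<close>])
    have "is_functor C D (\<lambda>a. p (F a))"
      by (rule is_functor_lift[OF F FD p])
    from univ[OF D this] obtain H where H: "is_functor P D H" "\<forall>a \<in> arr C. H (\<iota> a) = p (F a)"
      by (elim ex1E conjE)
    have "is_functor P G (restrict (\<lambda>x. q (H x)) (arr P))"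
      by (rule is_functor_cong[OF P.small_category_axioms is_functor_comp[OF H(1) q]]) simp
    moreover have "\<iota> a \<in> arr P" if "a \<in> arr C" for a
      using \<iota> that by (auto simp: is_functor_def)
    ultimately show ?thesis
      using H(2) FD p(1) by (intro exI[of _ "restrict (\<lambda>x. q (H x)) (arr P)"]) auto
  qed

  have uniq: "H1 x = H2 x"
    if H1: "is_functor P G H1" "\<forall>a \<in> arr C. H1 (\<iota> a) = F a"
      and H2: "is_functor P G H2" "\<forall>a \<in> arr C. H2 (\<iota> a) = F a" and x: "x \<in> arr P" for H1 H2 x
  proof -
    define K where "K = (\<lambda>(b, y). if b then H1 y else H2 y)"
    define c :: "((bool \<times> 'p) \<times> bool) \<Rightarrow> (('a + 'p) \<times> bool) list" where
      "c = (\<lambda>((b, y), s). [(Inr y, b), (Inr y, s)])"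
    define h :: "((bool \<times> 'p) \<times> bool) list \<Rightarrow> (('a + 'p) \<times> bool) list" where
      "h w = concat (map c w)" for w
    have "h w = h w' \<Longrightarrow> w = w'" for w w'
    proof (induction w arbitrary: w')
      case Nil
      then show ?case by (cases w') (auto simp: h_def c_def split: prod.splits)
    next
      case (Cons z w)
      then show ?case
        by (cases w') (auto simp: h_def c_def split: prod.splits)
    qed
    then have "inj h" by (rule injI)
    have K_arr: "K \<in> UNIV \<times> arr P \<rightarrow> arr G" using H1 H2 by (auto simp: is_functor_def K_def)
    obtain D :: "(('a + 'p) \<times> bool) list category" and q p where D: "groupoid D"
      and q: "is_functor D G q" and KD: "\<forall>a \<in> UNIV \<times> arr P. K a \<in> q ` arr D"
      and p: "\<forall>a \<in> q ` arr D. p a \<in> arr D \<and> q (p a) = a"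
        "\<forall>a \<in> q ` arr D. src G a \<in> q ` arr D \<and> rng G a \<in> q ` arr D \<and>
          src D (p a) = p (src G a) \<and> rng D (p a) = p (rng G a)"
        "\<forall>a \<in> q ` arr D. \<forall>b \<in> q ` arr D. src G a = rng G b \<longrightarrow>
          a \<cdot>\<^bsub>G\<^esub> b \<in> q ` arr D \<and> p (a \<cdot>\<^bsub>G\<^esub> b) = p a \<cdot>\<^bsub>D\<^esub> p b"
      by (rule G.span_copy[OF K_arr \<open>inj h\<close>])
    have HD: "H1 y \<in> q ` arr D" "H2 y \<in> q ` arr D" if "y \<in> arr P" for y
      using bspec[OF KD, of "(True, y)"] bspec[OF KD, of "(False, y)"] that by (auto simp: K_def)
    have lift: "is_functor P D (restrict (\<lambda>y. p (H y)) (arr P))"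
      if "is_functor P G H" "\<forall>y \<in> arr P. H y \<in> q ` arr D" for H
      by (rule is_functor_cong[OF P.small_category_axioms is_functor_lift[OF that p]]) simp
    have f: "is_functor P D (restrict (\<lambda>y. p (H1 y)) (arr P))"
      "is_functor P D (restrict (\<lambda>y. p (H2 y)) (arr P))"
      using lift[OF H1(1)] lift[OF H2(1)] HD by blast+
    have \<iota>P: "\<iota> a \<in> arr P" if "a \<in> arr C" for a using \<iota> that by (auto simp: is_functor_def)
    have "restrict (\<lambda>y. p (H1 y)) (arr P) = restrict (\<lambda>y. p (H2 y)) (arr P)"
    proof (rule ex1E[OF univ[OF D is_functor_comp[OF \<iota> f(1)]]])
      fix H
      assume *: "\<forall>H'. H' \<in> extensional (arr P) \<and> is_functor P D H' \<and>
        (\<forall>a\<in>arr C. H' (\<iota> a) = restrict (\<lambda>y. p (H1 y)) (arr P) (\<iota> a)) \<longrightarrow> H' = H"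
      have "restrict (\<lambda>y. p (H1 y)) (arr P) = H" using * f by auto
      moreover have "restrict (\<lambda>y. p (H2 y)) (arr P) = H"
        using *[rule_format, of "restrict (\<lambda>y. p (H2 y)) (arr P)"] f \<iota>P H1(2) H2(2) by auto
      ultimately show ?thesis by simp
    qed
    then have "p (H1 x) = p (H2 x)" using x by (metis restrict_apply')
    then show ?thesis using p(1) HD[OF x] by metis
  qed
  show ?thesis
    using ex uniq by (intro ex_ex1I) (auto intro: extensionalityI)
qed

end

theory Submission
  imports Defs "HOL-Library.Multiset"
begin

text \<open>
  Every element of \<open>\<Lambda>\<^bsub>k,R\<^esub>\<close> has exactly one factorisation into edges whose colours are weakly
  decreasing.  Moving an edge into such a word from the left by the rule
  \<open>(i,e)(j,f) = (j,f')(i,e')\<close> defines a product on these words; the Yang--Baxter equation makes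
  two consecutive moves commute, which yields associativity, and bijectivity of \<open>R\<close> yields the
  factorisation property.  Evaluating words identifies every such \<open>k\<close>-graph with this model.

  For \<open>R(e,f) = (\<sigma> f, e)\<close> and a colour \<open>j\<close>, map edges of colour above \<open>j\<close> to \<open>1\<close>, edges of colour
  below \<open>j\<close> to one element \<open>t\<close>, and edges \<open>(j,f)\<close> to elements \<open>g\<^sub>f\<close> that generate a free monoid and
  satisfy \<open>t g\<^sub>f = g\<^bsub>\<sigma> f\<^esub> t\<close>, all inside a permutation group.  This respects the relations and
  remembers the colour \<open>j\<close> part of a decreasing word, so together these functors to groups
  separate the elements of \<open>\<Lambda>\<^bsub>k,R\<^esub>\<close>.
\<close>

section \<open>Words with decreasing colours\<close>

definition words :: "nat \<Rightarrow> 'x set \<Rightarrow> (nat \<times> 'x) list set" where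
  "words k X = {w. set w \<subseteq> {1..k} \<times> X \<and> sorted_wrt (\<ge>) (map fst w)}"

text \<open>The new edge moves right only past strictly larger colours. It stops in front of its own
  colour, since no relation touches the order of edges of equal colour.\<close>

fun push :: "('x \<times> 'x \<Rightarrow> 'x \<times> 'x) \<Rightarrow> nat \<times> 'x \<Rightarrow> (nat \<times> 'x) list \<Rightarrow> (nat \<times> 'x) list" where
  "push R a [] = [a]"
| "push R a (b # w) =
     (if fst b \<le> fst a then a # b # w
      else (fst b, fst (R (snd a, snd b))) # push R (fst a, snd (R (snd a, snd b))) w)"

text \<open>The product inserts the letters of the left word one at a time, last letter first. Hence
  \<open>foldr (push R) u []\<close> makes sense for every edge word \<open>u\<close> and computes
  its decreasing normal form.\<close>

definition word_kgraph ::
    "nat \<Rightarrow> 'x set \<Rightarrow> ('x \<times> 'x \<Rightarrow> 'x \<times> 'x) \<Rightarrow> (nat \<times> 'x) list kgraph" where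
  "word_kgraph k X R =
     \<lparr>arr = words k X, src = (\<lambda>_. []), rng = (\<lambda>_. []), comp = foldr (push R),
      deg = (\<lambda>w. count_list (map fst w))\<rparr>"

lemma word_kgraph_sel [simp]:
  "arr (word_kgraph k X R) = words k X" "src (word_kgraph k X R) w = []"
  "rng (word_kgraph k X R) w = []" "comp (word_kgraph k X R) = foldr (push R)"
  "deg (word_kgraph k X R) w = count_list (map fst w)"
  by (simp_all add: word_kgraph_def)

lemma Nil_words [simp]: "[] \<in> words k X"
  by (simp add: words_def)

lemma Cons_words [simp]:
  "a # w \<in> words k X \<longleftrightarrow>
     fst a \<in> {1..k} \<and> snd a \<in> X \<and> w \<in> words k X \<and> (\<forall>b \<in> set w. fst b \<le> fst a)"
  by (cases a) (auto simp: words_def)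

section \<open>Colours and labels under insertion of an edge\<close>

lemma mset_push: "mset (map fst (push R a w)) = mset (map fst (a # w))"
  by (induction R a w rule: push.induct) auto

lemma fst_set_push: "fst ` set (push R a w) = insert (fst a) (fst ` set w)"
  using arg_cong[OF mset_push, of set_mset R a w] by simp

lemma words_set: "w \<in> words k X \<Longrightarrow> set w \<subseteq> {1..k} \<times> X"
  by (simp add: words_def)

lemma R_closed:
  assumes "R \<in> X \<times> X \<rightarrow> X \<times> X" "e \<in> X" "f \<in> X"
  shows "fst (R (e, f)) \<in> X" "snd (R (e, f)) \<in> X"
  using funcset_mem[OF assms(1), of "(e, f)"] assms(2,3) by (auto simp: mem_Times_iff)

lemma push_words:
  assumes R: "R \<in> X \<times> X \<rightarrow> X \<times> X"
  shows "\<lbrakk>fst a \<in> {1..k}; snd a \<in> X; w \<in> words k X\<rbrakk> \<Longrightarrow> push R a w \<in> words k X"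
proof (induction w arbitrary: a)
  case (Cons b w)
  show ?case
  proof (cases "fst b \<le> fst a")
    case False
    have "snd b \<in> X" using Cons.prems by simp
    note RX = R_closed[OF R Cons.prems(2) this]
    have "fst c \<le> fst b" if "c \<in> set (push R (fst a, snd (R (snd a, snd b))) w)" for c
    proof -
      have "fst c \<in> insert (fst a) (fst ` set w)"
        using that fst_set_push[of R "(fst a, snd (R (snd a, snd b)))" w] by auto
      then show ?thesis using False Cons.prems(3) by auto
    qed
    then show ?thesis
      using False Cons RX by simp
  qed (use Cons.prems in auto)
qed simp

lemma foldr_push_words:
  assumes R: "R \<in> X \<times> X \<rightarrow> X \<times> X" and "set u \<subseteq> {1..k} \<times> X" "w \<in> words k X"
  shows "foldr (push R) u w \<in> words k X"
  using assms(2) by (induction u) (auto simp: assms(3) intro!: push_words[OF R])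

text \<open>Building up a decreasing word never triggers an exchange; this is the right identity
  law.\<close>

lemma foldr_push_Nil: "w \<in> words k X \<Longrightarrow> foldr (push R) w [] = w"
proof (induction w)
  case (Cons a w)
  then show ?case by (cases w) auto
qed simp

lemma mset_foldr_push:
  "mset (map fst (foldr (push R) u w)) = mset (map fst u) + mset (map fst w)"
  by (induction u) (simp_all add: mset_push del: mset_map)

lemma count_foldr_push:
  "count_list (map fst (foldr (push R) u w)) = count_list (map fst u) + count_list (map fst w)"
  using mset_foldr_push[of R u w] by (simp add: fun_eq_iff flip: count_mset)

text \<open>The only use of the Yang--Baxter equation: both sides sort three edges of distinct colours.\<close>

lemma push_push:
  assumes R: "R \<in> X \<times> X \<rightarrow> X \<times> X" and YB: "yang_baxter X R"
  shows "\<lbrakk>e \<in> X; f \<in> X; w \<in> words k X; i < j\<rbrakk> \<Longrightarrow>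
    push R (i, e) (push R (j, f) w) = push R (j, fst (R (e, f))) (push R (i, snd (R (e, f))) w)"
proof (induction w arbitrary: e f)
  case (Cons b w)
  obtain l g where b: "b = (l, g)" by (cases b)
  have g: "g \<in> X" and w: "w \<in> words k X" using Cons.prems by (auto simp: b)
  show ?case
  proof (cases "l \<le> j")
    case True
    then show ?thesis using Cons.prems by (simp add: b)
  next
    case False
    obtain g1 f1 where fg: "R (f, g) = (g1, f1)" by fastforce
    obtain g2 e1 where eg: "R (e, g1) = (g2, e1)" by fastforce
    have "(g1, f1) \<in> X \<times> X" using funcset_mem[OF R, of "(f, g)"] Cons.prems(2) g fg by auto
    then have X: "f1 \<in> X" "e1 \<in> X"
      using funcset_mem[OF R, of "(e, g1)"] Cons.prems(1) eg by auto
    have "R12 R (R23 R (R12 R (e, f, g))) = R23 R (R12 R (R23 R (e, f, g)))"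
      using YB Cons.prems g by (simp add: yang_baxter_def)
    then show ?thesis
      using False Cons.prems(4) Cons.IH[OF X(2,1) w Cons.prems(4)]
      by (simp add: b fg eg R12_def R23_def split: prod.splits) (metis fst_conv snd_conv)
  qed
qed simp

section \<open>Associativity of the product of words\<close>

text \<open>The case of a single edge as left factor. If \<open>a\<close> is exchanged with the head
  \<open>b\<close>, the induction hypothesis leaves the two exchanged edges in front of
  \<open>foldr (push R) w z\<close>, and \<open>push_push\<close> turns them back into
  \<open>a\<close> and \<open>b\<close>.\<close>

lemma foldr_push_push:
  assumes R: "R \<in> X \<times> X \<rightarrow> X \<times> X" and YB: "yang_baxter X R"
    and z: "z \<in> words k X"
  shows "\<lbrakk>fst a \<in> {1..k}; snd a \<in> X; w \<in> words k X\<rbrakk> \<Longrightarrow>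
    foldr (push R) (push R a w) z = push R a (foldr (push R) w z)"
proof (induction w arbitrary: a)
  case (Cons b w)
  show ?case
  proof (cases "fst b \<le> fst a")
    case False
    have R': "R (snd a, snd b) \<in> X \<times> X" using R Cons.prems by auto
    have w: "foldr (push R) w z \<in> words k X"
      using Cons.prems by (intro foldr_push_words[OF R _ z]) (auto simp: words_def)
    have "push R (fst a, snd a) (push R (fst b, snd b) (foldr (push R) w z)) =
      push R (fst b, fst (R (snd a, snd b))) (push R (fst a, snd (R (snd a, snd b))) (foldr (push R) w z))"
      using Cons.prems False w by (intro push_push[OF R YB]) auto
    then show ?thesis using False Cons.prems R' by (auto simp: Cons.IH mem_Times_iff)
  qed simp
qed simp

lemma foldr_push_assoc:
  assumes R: "R \<in> X \<times> X \<rightarrow> X \<times> X" and YB: "yang_baxter X R"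
    and "u \<in> words k X" "w \<in> words k X" "z \<in> words k X"
  shows "foldr (push R) (foldr (push R) u w) z = foldr (push R) u (foldr (push R) w z)"
  using assms(3)
proof (induction u)
  case (Cons a u)
  have "foldr (push R) u w \<in> words k X"
    using Cons.prems assms(4) by (intro foldr_push_words[OF R]) (auto simp: words_def)
  then show ?case using Cons by (simp add: foldr_push_push[OF R YB assms(5)])
qed simp

lemma small_category_word_kgraph:
  assumes R: "R \<in> X \<times> X \<rightarrow> X \<times> X" and YB: "yang_baxter X R"
  shows "small_category (word_kgraph k X R)"
proof
  fix a b assume "a \<in> arr (word_kgraph k X R)" "b \<in> arr (word_kgraph k X R)"
  then show "a \<cdot>\<^bsub>word_kgraph k X R\<^esub> b \<in> arr (word_kgraph k X R)"
    using foldr_push_words[OF R words_set] by simp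
qed (simp_all add: obj_def foldr_push_Nil foldr_push_assoc[OF assms])

section \<open>Degrees and decreasing colour sequences\<close>

text \<open>Equal counts mean equal multisets, and a multiset has only one decreasing
  arrangement.\<close>

lemma decreasing_unique:
  assumes "sorted_wrt (\<ge>) cs" "sorted_wrt (\<ge>) cs'" "count_list cs = count_list cs'"
  shows "cs = (cs' :: nat list)"
proof -
  have "mset cs = mset cs'"
    using assms(3) by (intro multiset_eqI) (simp add: count_mset)
  moreover have "sorted (rev cs)" "sorted (rev cs')"
    using assms(1,2) by (simp_all add: sorted_wrt_rev)
  ultimately have "rev cs = rev cs'"
    by (metis mset_rev properties_for_sort)
  then show ?thesis by simp
qed

lemma decreasing_exists:
  assumes "n \<in> Nk k"
  obtains cs where "sorted_wrt (\<ge>) cs" "count_list cs = n" "set cs \<subseteq> {1..k}"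
proof -
  have "\<exists>cs. sorted_wrt (\<ge>) cs \<and> count_list cs = n \<and> set cs \<subseteq> {1..k}"
    using assms
  proof (induction k arbitrary: n)
    case 0
    then show ?case by (intro exI[of _ "[]"]) (auto simp: Nk_def)
  next
    case (Suc k)
    have "n(Suc k := 0) \<in> Nk k" using Suc.prems by (auto simp: Nk_def)
    from Suc.IH[OF this] obtain cs where
      cs: "sorted_wrt (\<ge>) cs" "count_list cs = n(Suc k := 0)" "set cs \<subseteq> {1..k}" by blast
    have [simp]: "count_list (replicate m c) i = (if i = c then m else 0)" for m and c i :: nat
      by (induction m) auto
    have "sorted_wrt (\<ge>) (replicate m c)" for m and c :: nat
      by (induction m) auto
    then show ?case
      \<comment> \<open>The largest colour \<open>Suc k\<close> goes in front of the list obtained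
        for the smaller colours.\<close>
      using cs by (intro exI[of _ "replicate (n (Suc k)) (Suc k) @ cs"])
        (force simp: sorted_wrt_append fun_eq_iff)
  qed
  then show thesis using that by blast
qed

lemma words_same_colours:
  assumes "u \<in> words k X" "w \<in> words k X"
    "count_list (map fst u) = count_list (map fst w)"
  shows "map fst u = map fst w"
  using assms by (intro decreasing_unique) (auto simp: words_def)

section \<open>The factorisation property\<close>

text \<open>Equal colours force the same exchanges on both sides. At each exchange the first
  component of \<open>R\<close> is the visible head and the second is carried on; the induction
  hypothesis identifies the carried labels, and injectivity of \<open>R\<close> then recovers the
  original pair.\<close>

lemma push_inject:
  assumes R: "R \<in> X \<times> X \<rightarrow> X \<times> X" and inj: "inj_on R (X \<times> X)"
  shows "\<lbrakk>push R (i, e) u = push R (i, f) w; map fst u = map fst w; e \<in> X; f \<in> X;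
    u \<in> words k X; w \<in> words k X\<rbrakk> \<Longrightarrow> e = f \<and> u = w"
proof (induction u arbitrary: e f w)
  case (Cons b u)
  obtain c w' where w: "w = c # w'" "fst b = fst c" "map fst u = map fst w'"
    using Cons.prems(2) by (cases w) auto
  show ?case
  proof (cases "fst b \<le> i")
    case True
    then show ?thesis using Cons.prems w by auto
  next
    case False
    have X: "(e, snd b) \<in> X \<times> X" "(f, snd c) \<in> X \<times> X" using Cons.prems w by auto
    then have RX: "snd (R (e, snd b)) \<in> X" "snd (R (f, snd c)) \<in> X"
      using R_closed[OF R] by auto
    have eq: "fst (R (e, snd b)) = fst (R (f, snd c))"
      "push R (i, snd (R (e, snd b))) u = push R (i, snd (R (f, snd c))) w'"
      using Cons.prems(1) False w by auto
    have "snd (R (e, snd b)) = snd (R (f, snd c)) \<and> u = w'"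
      using Cons.prems w RX by (intro Cons.IH[OF eq(2)]) auto
    then show ?thesis
      using inj_onD[OF inj _ X] eq(1) w by (auto simp: prod_eq_iff)
  qed
qed simp

text \<open>Here \<open>u\<close> and \<open>w\<close> need not be decreasing: a normal form
  determines its factorisation into edges along any prescribed colour sequence.\<close>

lemma foldr_push_inject:
  assumes R: "R \<in> X \<times> X \<rightarrow> X \<times> X" and inj: "inj_on R (X \<times> X)"
  shows "\<lbrakk>foldr (push R) u [] = foldr (push R) w []; map fst u = map fst w;
    set u \<subseteq> {1..k} \<times> X; set w \<subseteq> {1..k} \<times> X\<rbrakk> \<Longrightarrow> u = w"
proof (induction u arbitrary: w)
  case (Cons a u)
  obtain c w' where w: "w = c # w'" "fst a = fst c" "map fst u = map fst w'"
    using Cons.prems(2) by (cases w) auto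
  have fw: "foldr (push R) u [] \<in> words k X" "foldr (push R) w' [] \<in> words k X"
    using Cons.prems w by (auto intro!: foldr_push_words[OF R])
  have "map fst (foldr (push R) u []) = map fst (foldr (push R) w' [])"
    using fw w(3) by (intro words_same_colours) (auto simp: count_foldr_push)
  then have "snd a = snd c \<and> foldr (push R) u [] = foldr (push R) w' []"
    using Cons.prems w fw
    by (intro push_inject[OF R inj, where i = "fst a" and k = k]) auto
  then show ?case using Cons w by (auto simp: prod_eq_iff)
qed simp

text \<open>The first edge of colour \<open>i\<close> is moved to the front by undoing exchanges,
  which surjectivity of \<open>R\<close> permits.\<close>

lemma push_surj:
  assumes R: "bij_betw R (X \<times> X) (X \<times> X)"
  shows "\<lbrakk>a \<in> words k X; i \<in> fst ` set a\<rbrakk> \<Longrightarrow> \<exists>e \<in> X. \<exists>w \<in> words k X. a = push R (i, e) w"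
proof (induction a)
  case (Cons b a)
  show ?case
  proof (cases "fst b = i")
    case True
    then show ?thesis using Cons.prems
      by (intro bexI[of _ "snd b"] bexI[of _ a]) (cases a; auto)+
  next
    case False
    then have "i \<in> fst ` set a" using Cons.prems by auto
    with Cons obtain e w where ew: "e \<in> X" "w \<in> words k X" "a = push R (i, e) w" by auto
    \<comment> \<open>The edge \<open>(i, e)\<close> already stands at the front of the tail; a
      preimage under \<open>R\<close> supplies the labels before its exchange with
      \<open>b\<close>.\<close>
    have "(snd b, e) \<in> R ` (X \<times> X)" using R ew Cons.prems by (auto simp: bij_betw_def)
    then obtain e' f' where ef: "e' \<in> X" "f' \<in> X" "R (e', f') = (snd b, e)" by auto
    have "fst c \<le> fst b" if "c \<in> set w" for c
    proof -
      have "fst c \<in> fst ` set a" using that ew(3) by (simp add: fst_set_push)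
      then show ?thesis using Cons.prems(1) by auto
    qed
    then have "(fst b, f') # w \<in> words k X" using Cons.prems ew ef by auto
    moreover have "i < fst b" using False Cons.prems \<open>i \<in> fst ` set a\<close> by force
    then have "b # a = push R (i, e') ((fst b, f') # w)"
      using ew ef by simp
    ultimately show ?thesis using ef by blast
  qed
qed simp

text \<open>Each colour of \<open>cs\<close> in turn is brought to the front by
  \<open>push_surj\<close>, so a normal word factors along every arrangement of its colours.\<close>

lemma foldr_push_surj:
  assumes R: "bij_betw R (X \<times> X) (X \<times> X)"
  shows "\<lbrakk>a \<in> words k X; count_list (map fst a) = count_list cs\<rbrakk> \<Longrightarrow>
    \<exists>w. map fst w = cs \<and> set w \<subseteq> {1..k} \<times> X \<and> foldr (push R) w [] = a"
proof (induction cs arbitrary: a)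
  case Nil
  then have "map fst a = []"
    by (intro decreasing_unique) (auto simp: words_def)
  then show ?case by simp
next
  case (Cons i cs)
  have ms: "mset (map fst a) = mset (i # cs)"
    using Cons.prems(2) by (intro multiset_eqI) (simp only: count_mset)
  then have i: "i \<in> fst ` set a"
    by (metis list.set_intros(1) list.set_map set_mset_mset)
  from push_surj[OF R Cons.prems(1) this] obtain e w where
    ew: "e \<in> X" "w \<in> words k X" "a = push R (i, e) w" by blast
  have "mset (map fst w) = mset cs"
    using ms ew(3) mset_push[of R "(i, e)" w] by simp
  then have "count_list (map fst w) = count_list cs"
    by (simp add: fun_eq_iff flip: count_mset)
  from Cons.IH[OF ew(2) this] obtain u where
    u: "map fst u = cs" "set u \<subseteq> {1..k} \<times> X" "foldr (push R) u [] = w" by blast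
  have "i \<in> {1..k}" using i Cons.prems(1) by (auto simp: words_def)
  then show ?case using u ew by (intro exI[of _ "(i, e) # u"]) auto
qed

text \<open>Let \<open>cs\<close> and \<open>ds\<close> be the decreasing colour sequences of
  degrees \<open>m\<close> and \<open>n\<close>. Factorisations into these degrees correspond to
  edge words with colours \<open>cs @ ds\<close>, cut after \<open>cs\<close>;
  \<open>foldr_push_surj\<close> gives existence and \<open>foldr_push_inject\<close>
  uniqueness.\<close>

lemma k_graph_word_kgraph:
  assumes R: "bij_betw R (X \<times> X) (X \<times> X)" and YB: "yang_baxter X R"
  shows "k_graph k (word_kgraph k X R)"
proof -
  have RX: "R \<in> X \<times> X \<rightarrow> X \<times> X" and inj: "inj_on R (X \<times> X)"
    using R by (auto simp: bij_betw_def)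
  interpret small_category "word_kgraph k X R"
    by (rule small_category_word_kgraph[OF RX YB])
  show ?thesis
  proof
    fix a assume "a \<in> arr (word_kgraph k X R)"
    then show "deg (word_kgraph k X R) a \<in> Nk k"
      by (auto simp: Nk_def words_def count_list_0_iff)
  next
    fix v assume "v \<in> obj (word_kgraph k X R)"
    then show "deg (word_kgraph k X R) v = 0" by (auto simp: obj_def fun_eq_iff)
  next
    fix a b
    show "deg (word_kgraph k X R) (a \<cdot>\<^bsub>word_kgraph k X R\<^esub> b) =
      deg (word_kgraph k X R) a + deg (word_kgraph k X R) b"
      by (simp add: count_foldr_push)
  next
    fix a m n
    assume a: "a \<in> arr (word_kgraph k X R)" and m: "m \<in> Nk k" and n: "n \<in> Nk k"
      and mn: "deg (word_kgraph k X R) a = m + n"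
    obtain cs where cs: "sorted_wrt (\<ge>) cs" "count_list cs = m" by (rule decreasing_exists[OF m])
    obtain ds where ds: "sorted_wrt (\<ge>) ds" "count_list ds = n" by (rule decreasing_exists[OF n])
    have "count_list (map fst a) = count_list (cs @ ds)"
      using mn cs ds by (auto simp: fun_eq_iff)
    with a obtain w where w: "map fst w = cs @ ds" "set w \<subseteq> {1..k} \<times> X" "foldr (push R) w [] = a"
      using foldr_push_surj[OF R] by fastforce
    from w(1) obtain b c where bc: "w = b @ c" "map fst b = cs" "map fst c = ds"
      by (auto simp: map_eq_append_conv)
    have words: "b \<in> words k X" "c \<in> words k X"
      using w bc cs ds by (auto simp: words_def)
    show "\<exists>!(b, c). b \<in> arr (word_kgraph k X R) \<and> c \<in> arr (word_kgraph k X R) \<and>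
      src (word_kgraph k X R) b = rng (word_kgraph k X R) c \<and>
      deg (word_kgraph k X R) b = m \<and> deg (word_kgraph k X R) c = n \<and>
      a = b \<cdot>\<^bsub>word_kgraph k X R\<^esub> c"
    proof (rule ex1I[of _ "(b, c)"]; clarsimp)
      show "b \<in> words k X \<and> c \<in> words k X \<and> count_list (map fst b) = m \<and>
        count_list (map fst c) = n \<and> a = foldr (push R) b c"
        using words bc cs ds w(3) foldr_push_Nil[OF words(2)] by auto
    next
      fix b' c'
      assume *: "b' \<in> words k X" "c' \<in> words k X" "m = count_list (map fst b')"
        "n = count_list (map fst c')" "a = foldr (push R) b' c'"
      have cols: "map fst b' = map fst b" "map fst c' = map fst c"
        using * words bc cs ds by (auto intro!: words_same_colours)
      have "b' @ c' = b @ c"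
      proof (rule foldr_push_inject[OF RX inj])
        show "foldr (push R) (b' @ c') [] = foldr (push R) (b @ c) []"
          using * w(3) bc(1) foldr_push_Nil[OF *(2)] by simp
        show "map fst (b' @ c') = map fst (b @ c)" using cols by simp
        show "set (b' @ c') \<subseteq> {1..k} \<times> X" "set (b @ c) \<subseteq> {1..k} \<times> X"
          using * words by (auto simp: words_def)
      qed
      then show "b' = b \<and> c' = c" using map_eq_imp_length_eq[OF cols(1)] by simp
    qed
  qed
qed

lemma yb_kgraph_word_kgraph:
  assumes R: "bij_betw R (X \<times> X) (X \<times> X)" and YB: "yang_baxter X R"
  shows "yb_kgraph k X R (word_kgraph k X R) (\<lambda>a. [a])"
  unfolding yb_kgraph_def
proof (intro conjI ballI allI impI)
  show "k_graph k (word_kgraph k X R)" by (rule k_graph_word_kgraph[OF assms])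
  have "w = []" if "w \<in> words k X" "count_list (map fst w) = 0" for w
    using that words_same_colours[of w k X "[]"] by (auto simp: fun_eq_iff)
  then show "\<exists>v. of_deg (word_kgraph k X R) 0 = {v}"
    by (intro exI[of _ "[]"]) (auto simp: of_deg_def fun_eq_iff)
next
  fix i assume i: "i \<in> {1..k}"
  have "w \<in> (\<lambda>a. [a]) ` ({i} \<times> X)" if "w \<in> words k X" "count_list (map fst w) = gen i" for w
  proof -
    have "map fst w = [i]"
      using that by (intro decreasing_unique) (auto simp: words_def gen_def fun_eq_iff)
    then show ?thesis using that by auto
  qed
  then have "of_deg (word_kgraph k X R) (gen i) = (\<lambda>a. [a]) ` ({i} \<times> X)"
    using i by (auto simp: of_deg_def gen_def fun_eq_iff)
  then show "bij_betw (\<lambda>a. [a]) ({i} \<times> X) (of_deg (word_kgraph k X R) (gen i))"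
    by (simp add: bij_betw_def inj_on_def)
\<comment> \<open>What remains is the commutation rule: the left product makes one exchange, and the
  right product is already decreasing.\<close>
qed auto

section \<open>Evaluating words\<close>

text \<open>A one-object category with chosen elements satisfying the edge relations. It serves
  twice: for a given \<open>k\<close>-graph with its own edges, and for a permutation group.\<close>

locale yb_rep = small_category D
  for D :: "('d, 'm) category_scheme" (structure) +
  fixes k :: nat and X :: "'x set" and R :: "'x \<times> 'x \<Rightarrow> 'x \<times> 'x" and v :: 'd and \<eta> :: "nat \<times> 'x \<Rightarrow> 'd"
  assumes obj: "obj D = {v}"
    and R: "R \<in> X \<times> X \<rightarrow> X \<times> X"
    and \<eta>: "\<eta> \<in> {1..k} \<times> X \<rightarrow> arr D"
    and rel: "\<lbrakk>i \<in> {1..k}; j \<in> {1..k}; e \<in> X; f \<in> X; i < j\<rbrakk> \<Longrightarrow>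
      \<eta> (i, e) \<cdot> \<eta> (j, f) = \<eta> (j, fst (R (e, f))) \<cdot> \<eta> (i, snd (R (e, f)))"
begin

definition eval :: "(nat \<times> 'x) list \<Rightarrow> 'd" where
  "eval w = foldr (\<lambda>a. (\<cdot>) (\<eta> a)) w v"

lemma eval_simps [simp]: "eval [] = v" "eval (a # w) = \<eta> a \<cdot> eval w"
  by (simp_all add: eval_def)

lemma v_arr [simp]: "v \<in> arr D" "src D v = v" "rng D v = v"
  using obj by (auto simp: obj_def)

lemma src_rng [simp]: "a \<in> arr D \<Longrightarrow> src D a = v" "a \<in> arr D \<Longrightarrow> rng D a = v"
  using src_obj rng_obj obj by auto

lemma \<eta>_arr [simp]: "i \<in> {1..k} \<Longrightarrow> e \<in> X \<Longrightarrow> \<eta> (i, e) \<in> arr D"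
  using \<eta> by auto

lemma eval_arr: "set w \<subseteq> {1..k} \<times> X \<Longrightarrow> eval w \<in> arr D"
  by (induction w) (auto intro!: comp_arr)

text \<open>Every exchange made by \<open>push\<close> is an instance of \<open>rel\<close>, so it
  does not change the product.\<close>

lemma eval_push:
  "\<lbrakk>i \<in> {1..k}; e \<in> X; w \<in> words k X\<rbrakk> \<Longrightarrow> eval (push R (i, e) w) = \<eta> (i, e) \<cdot> eval w"
proof (induction w arbitrary: e)
  case (Cons b w)
  obtain j f where b: "b = (j, f)" by (cases b)
  have X: "f \<in> X" "j \<in> {1..k}" "w \<in> words k X" and R': "R (e, f) \<in> X \<times> X"
    using Cons.prems R by (auto simp: b)
  have w: "eval w \<in> arr D" using X by (intro eval_arr) (auto simp: words_def)
  show ?case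
  proof (cases "j \<le> i")
    case False
    have "eval (push R (i, e) (b # w)) =
        \<eta> (j, fst (R (e, f))) \<cdot> (\<eta> (i, snd (R (e, f))) \<cdot> eval w)"
      using False Cons.prems X R' by (simp add: b Cons.IH mem_Times_iff)
    also have "\<dots> = (\<eta> (i, e) \<cdot> \<eta> (j, f)) \<cdot> eval w"
      using False Cons.prems X R' w rel[of i j e f] by (subst assoc[symmetric]) (auto simp: mem_Times_iff)
    also have "\<dots> = \<eta> (i, e) \<cdot> eval (b # w)"
      using Cons.prems X w by (subst assoc) (auto simp: b)
    finally show ?thesis .
  qed (simp add: b)
qed simp

lemma eval_foldr_push:
  assumes "w \<in> words k X"
  shows "set u \<subseteq> {1..k} \<times> X \<Longrightarrow> eval (foldr (push R) u w) = eval u \<cdot> eval w"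
proof (induction u)
  case Nil
  have "eval w \<in> arr D" using assms by (intro eval_arr) (auto simp: words_def)
  then show ?case using id_left[of "eval w"] by simp
next
  case (Cons a u)
  have "foldr (push R) u w \<in> words k X" "eval u \<in> arr D" "eval w \<in> arr D"
    using Cons.prems assms words_set[OF assms] by (auto intro!: foldr_push_words[OF R] eval_arr)
  then show ?case using Cons by (cases a) (auto simp: eval_push assoc)
qed

lemma is_functor_eval: "is_functor (word_kgraph k X R) D eval"
  unfolding is_functor_def by (auto simp: eval_arr[OF words_set] eval_foldr_push[OF _ words_set])

end

section \<open>Comparison of a given \<open>k\<close>-graph with the word model\<close>

lemma yb_rep_kgraph:
  assumes "yb_kgraph k X R \<Lambda> \<eta>" and R: "R \<in> X \<times> X \<rightarrow> X \<times> X"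
  obtains v where "yb_rep \<Lambda> k X R v \<eta>"
proof -
  interpret k_graph k \<Lambda> using assms by (simp add: yb_kgraph_def)
  obtain v where v: "of_deg \<Lambda> 0 = {v}" using assms by (auto simp: yb_kgraph_def)
  \<comment> \<open>Vertices have degree 0, so \<open>v\<close> is the only candidate; the source of
    \<open>v\<close> shows that a vertex exists.\<close>
  have "obj \<Lambda> \<subseteq> {v}" using deg_obj v by (auto simp: of_deg_def obj_def)
  moreover have "v \<in> arr \<Lambda>" using v by (auto simp: of_deg_def)
  then have "src \<Lambda> v \<in> obj \<Lambda>" by (rule src_obj)
  ultimately have "obj \<Lambda> = {v}" by auto
  moreover have "\<eta> \<in> {1..k} \<times> X \<rightarrow> arr \<Lambda>"
  proof
    fix a assume "a \<in> {1..k} \<times> X"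
    then have "\<eta> a \<in> of_deg \<Lambda> (gen (fst a))"
      using assms(1) unfolding yb_kgraph_def bij_betw_def by force
    then show "\<eta> a \<in> arr \<Lambda>" by (simp add: of_deg_def)
  qed
  ultimately have "yb_rep \<Lambda> k X R v \<eta>"
    using assms R by unfold_locales (auto simp: yb_kgraph_def prod_eq_iff)
  then show thesis by (rule that)
qed

text \<open>The isomorphism is \<open>eval\<close>. Unique factorisation in \<open>\<Lambda>\<close>
  splits off one edge of a prescribed colour at a time, which makes \<open>eval\<close> bijective
  from edge words of a fixed colour sequence to morphisms of the matching degree.\<close>

lemma kgraph_iso_word_kgraph:
  assumes yb: "yb_kgraph k X R \<Lambda> \<eta>" and RX: "R \<in> X \<times> X \<rightarrow> X \<times> X"
  obtains \<phi> where "kgraph_iso (word_kgraph k X R) \<Lambda> \<phi>"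
    "\<forall>i \<in> {1..k}. \<forall>e \<in> X. \<phi> [(i, e)] = \<eta> (i, e)"
proof -
  interpret k_graph k \<Lambda> using yb by (simp add: yb_kgraph_def)
  obtain v where "yb_rep \<Lambda> k X R v \<eta>" by (rule yb_rep_kgraph[OF assms])
  then interpret yb_rep \<Lambda> k X R v \<eta> .
  have \<eta>_bij: "bij_betw \<eta> ({i} \<times> X) (of_deg \<Lambda> (gen i))" if "i \<in> {1..k}" for i
    using yb that by (simp add: yb_kgraph_def)
  have deg_\<eta>: "deg \<Lambda> (\<eta> (i, e)) = gen i" if "i \<in> {1..k}" "e \<in> X" for i e
    using \<eta>_bij[OF that(1)] that by (auto simp: bij_betw_def of_deg_def)
  have deg_eval: "deg \<Lambda> (eval w) = count_list (map fst w)" if "set w \<subseteq> {1..k} \<times> X" for w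
    using that
  proof (induction w)
    case Nil
    then show ?case using obj deg_obj by (auto simp: fun_eq_iff)
  next
    case (Cons a w)
    then have "deg \<Lambda> (eval (a # w)) = deg \<Lambda> (\<eta> a) + deg \<Lambda> (eval w)"
      by (cases a) (simp add: deg_comp eval_arr)
    then show ?case using Cons by (cases a) (auto simp: deg_\<eta> gen_def fun_eq_iff)
  qed
  have gen_Nk: "gen i \<in> Nk k" if "i \<in> {1..k}" for i
    using that by (auto simp: gen_def Nk_def)
  have count_Nk: "count_list cs \<in> Nk k" if "set cs \<subseteq> {1..k}" for cs
    using that by (auto simp: Nk_def count_list_0_iff)
  have count_Cons: "count_list (i # cs) = gen i + count_list cs" for i cs
    by (auto simp: gen_def fun_eq_iff)
  have inj: "u = w" if "eval u = eval w" "map fst u = map fst w"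
    "set u \<subseteq> {1..k} \<times> X" "set w \<subseteq> {1..k} \<times> X" for u w
    using that
  proof (induction u arbitrary: w)
    case (Cons a u)
    obtain i e where a: "a = (i, e)" by (cases a)
    with Cons.prems obtain f w' where w: "w = (i, f) # w'" "map fst u = map fst w'"
      by (cases w) auto
    have i: "i \<in> {1..k}" "e \<in> X" "f \<in> X" using Cons.prems by (auto simp: a w)
    have u: "set u \<subseteq> {1..k} \<times> X" and w': "set w' \<subseteq> {1..k} \<times> X"
      using Cons.prems by (auto simp: w)
    have n: "count_list (map fst u) \<in> Nk k" using u by (intro count_Nk) auto
    have "eval (a # u) \<in> arr \<Lambda>" using Cons.prems by (intro eval_arr)
    moreover have "deg \<Lambda> (eval (a # u)) = gen i + count_list (map fst u)"
      using deg_eval[OF Cons.prems(3)] a count_Cons by simp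
    ultimately have ex1: "\<exists>!z. (\<lambda>(b, c). b \<in> arr \<Lambda> \<and> c \<in> arr \<Lambda> \<and> src \<Lambda> b = rng \<Lambda> c \<and>
        deg \<Lambda> b = gen i \<and> deg \<Lambda> c = count_list (map fst u) \<and> eval (a # u) = b \<cdot>\<^bsub>\<Lambda>\<^esub> c) z"
      by (rule factorisation[OF _ gen_Nk[OF i(1)] n])
    have "(\<eta> (i, e), eval u) = (\<eta> (i, f), eval w')"
    proof (rule Uniq_D[OF conjunct2[OF ex1[unfolded ex1_iff_ex_Uniq]]])
      show "case (\<eta> (i, e), eval u) of (b, c) \<Rightarrow> b \<in> arr \<Lambda> \<and> c \<in> arr \<Lambda> \<and> src \<Lambda> b = rng \<Lambda> c \<and>
        deg \<Lambda> b = gen i \<and> deg \<Lambda> c = count_list (map fst u) \<and> eval (a # u) = b \<cdot>\<^bsub>\<Lambda>\<^esub> c"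
        using i deg_\<eta> deg_eval[OF u] eval_arr[OF u] by (simp add: a)
      show "case (\<eta> (i, f), eval w') of (b, c) \<Rightarrow> b \<in> arr \<Lambda> \<and> c \<in> arr \<Lambda> \<and> src \<Lambda> b = rng \<Lambda> c \<and>
        deg \<Lambda> b = gen i \<and> deg \<Lambda> c = count_list (map fst u) \<and> eval (a # u) = b \<cdot>\<^bsub>\<Lambda>\<^esub> c"
        using i deg_\<eta> deg_eval[OF w'] eval_arr[OF w'] w Cons.prems(1) by simp
    qed
    then have "e = f" "eval u = eval w'"
      using \<eta>_bij[OF i(1)] i by (auto simp: bij_betw_def inj_on_def)
    then show ?case using Cons.IH w u w' a by auto
  qed simp
  have surj: "\<exists>w. map fst w = cs \<and> set w \<subseteq> {1..k} \<times> X \<and> eval w = a"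
    if "a \<in> arr \<Lambda>" "deg \<Lambda> a = count_list cs" "set cs \<subseteq> {1..k}" for a cs
    using that
  proof (induction cs arbitrary: a)
    case Nil
    then have "a \<in> of_deg \<Lambda> 0" "v \<in> of_deg \<Lambda> 0"
      using deg_obj obj by (auto simp: of_deg_def fun_eq_iff)
    then have "a = v" using yb by (auto simp: yb_kgraph_def)
    then show ?case by simp
  next
    case (Cons i cs)
    then have i: "i \<in> {1..k}" and n: "count_list cs \<in> Nk k" by (auto intro!: count_Nk)
    have "deg \<Lambda> a = gen i + count_list cs" using Cons.prems(2) by (simp only: count_Cons)
    from ex1_implies_ex[OF factorisation[OF Cons.prems(1) gen_Nk[OF i] n this]] obtain b c where
      bc: "b \<in> arr \<Lambda>" "c \<in> arr \<Lambda>" "deg \<Lambda> b = gen i" "deg \<Lambda> c = count_list cs" "a = b \<cdot>\<^bsub>\<Lambda>\<^esub> c"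
      by auto
    have "b \<in> \<eta> ` ({i} \<times> X)" using \<eta>_bij[OF i] bc by (auto simp: bij_betw_def of_deg_def)
    then obtain e where e: "e \<in> X" "b = \<eta> (i, e)" by auto
    from Cons.IH[OF bc(2,4)] Cons.prems obtain w where
      "map fst w = cs" "set w \<subseteq> {1..k} \<times> X" "eval w = c" by auto
    then show ?case using e i bc by (intro exI[of _ "(i, e) # w"]) auto
  qed
  have "bij_betw eval (words k X) (arr \<Lambda>)"
    unfolding bij_betw_def
  proof
    show "inj_on eval (words k X)"
    proof (rule inj_onI)
      fix u w assume uw: "u \<in> words k X" "w \<in> words k X" "eval u = eval w"
      then have s: "set u \<subseteq> {1..k} \<times> X" "set w \<subseteq> {1..k} \<times> X" by (auto simp: words_def)
      then have "map fst u = map fst w"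
        using uw deg_eval[OF s(1)] deg_eval[OF s(2)] by (intro words_same_colours) auto
      then show "u = w" using inj uw s by blast
    qed
    have "a \<in> eval ` words k X" if a: "a \<in> arr \<Lambda>" for a
    proof -
      \<comment> \<open>Taking the colour sequence decreasing puts the resulting edge word into
        \<open>words k X\<close>.\<close>
      obtain cs where cs: "sorted_wrt (\<ge>) cs" "count_list cs = deg \<Lambda> a" "set cs \<subseteq> {1..k}"
        by (rule decreasing_exists[OF deg_Nk[OF a]])
      with surj[OF a] obtain w where "map fst w = cs" "set w \<subseteq> {1..k} \<times> X" "eval w = a" by metis
      then show ?thesis using cs by (auto simp: words_def)
    qed
    then show "eval ` words k X = arr \<Lambda>" by (auto simp: words_def eval_arr)
  qed
  then have "kgraph_iso (word_kgraph k X R) \<Lambda> eval"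
    using is_functor_eval by (auto simp: kgraph_iso_def deg_eval words_def)
  moreover have "eval [(i, e)] = \<eta> (i, e)" if "i \<in> {1..k}" "e \<in> X" for i e
    using id_right[of "\<eta> (i, e)"] that by simp
  ultimately show thesis using that by blast
qed

section \<open>Inverses and composites of isomorphisms\<close>

lemma kgraph_iso_inverse:
  assumes \<phi>: "kgraph_iso \<Lambda> \<Lambda>' \<phi>" and \<Lambda>: "small_category \<Lambda>"
  shows "kgraph_iso \<Lambda>' \<Lambda> (inv_into (arr \<Lambda>) \<phi>)"
proof -
  interpret \<Lambda>: small_category \<Lambda> by fact
  let ?\<psi> = "inv_into (arr \<Lambda>) \<phi>"
  have bij: "bij_betw \<phi> (arr \<Lambda>) (arr \<Lambda>')" and F: "is_functor \<Lambda> \<Lambda>' \<phi>"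
    and deg: "\<forall>a \<in> arr \<Lambda>. deg \<Lambda>' (\<phi> a) = deg \<Lambda> a"
    using \<phi> by (auto simp: kgraph_iso_def)
  have inv [simp]: "?\<psi> (\<phi> a) = a" if "a \<in> arr \<Lambda>" for a
    using bij that by (simp add: bij_betw_inv_into_left)
  have sr: "src \<Lambda> a \<in> arr \<Lambda>" "rng \<Lambda> a \<in> arr \<Lambda>" if "a \<in> arr \<Lambda>" for a
    using \<Lambda>.src_obj[OF that] \<Lambda>.rng_obj[OF that] by (auto simp: obj_def)
  have arr: "arr \<Lambda>' = \<phi> ` arr \<Lambda>" using bij by (simp add: bij_betw_def)
  have inj: "\<phi> a = \<phi> b \<longleftrightarrow> a = b" if "a \<in> arr \<Lambda>" "b \<in> arr \<Lambda>" for a b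
    using bij that by (auto simp: bij_betw_def inj_on_eq_iff)
  have comp: "?\<psi> (\<phi> a \<cdot>\<^bsub>\<Lambda>'\<^esub> \<phi> b) = a \<cdot>\<^bsub>\<Lambda>\<^esub> b"
    if "a \<in> arr \<Lambda>" "b \<in> arr \<Lambda>" "src \<Lambda> a = rng \<Lambda> b" for a b
  proof -
    have "\<phi> a \<cdot>\<^bsub>\<Lambda>'\<^esub> \<phi> b = \<phi> (a \<cdot>\<^bsub>\<Lambda>\<^esub> b)" using F that by (simp add: is_functor_def)
    then show ?thesis using that by (simp add: \<Lambda>.comp_arr)
  qed
  show ?thesis
    unfolding kgraph_iso_def
  proof (intro conjI)
    show "is_functor \<Lambda>' \<Lambda> ?\<psi>"
      using F sr comp by (auto simp: is_functor_def arr inj)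
    show "bij_betw ?\<psi> (arr \<Lambda>') (arr \<Lambda>)" by (rule bij_betw_inv_into[OF bij])
    show "\<forall>a \<in> arr \<Lambda>'. deg \<Lambda> (?\<psi> a) = deg \<Lambda>' a" using deg by (auto simp: arr)
  qed
qed

lemma kgraph_iso_comp:
  assumes "kgraph_iso A B \<phi>" "kgraph_iso B C \<psi>"
  shows "kgraph_iso A C (\<lambda>a. \<psi> (\<phi> a))"
proof -
  have "bij_betw (\<psi> \<circ> \<phi>) (arr A) (arr C)"
    using assms by (auto simp: kgraph_iso_def intro: bij_betw_trans)
  moreover have "\<phi> a \<in> arr B" if "a \<in> arr A" for a
    using assms(1) that by (auto simp: kgraph_iso_def is_functor_def)
  ultimately show ?thesis
    using assms is_functor_comp[of A B \<phi> C \<psi>] by (auto simp: kgraph_iso_def o_def)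
qed

section \<open>Separation by permutation groups\<close>

definition perm_groupoid :: "('y \<Rightarrow> 'y) category" where
  "perm_groupoid = \<lparr>arr = {f. bij f}, src = (\<lambda>_. id), rng = (\<lambda>_. id), comp = (\<circ>)\<rparr>"

lemma obj_perm_groupoid: "obj perm_groupoid = {id}"
  by (auto simp: perm_groupoid_def obj_def)

lemma groupoid_perm_groupoid: "groupoid perm_groupoid"
proof
  fix a :: "'a \<Rightarrow> 'a" assume "a \<in> arr perm_groupoid"
  then have "bij a" by (simp add: perm_groupoid_def)
  then have "a \<circ> inv a = id" "inv a \<circ> a = id"
    using bij_is_surj[of a] by (simp_all add: bij_is_inj surj_iff)
  with \<open>bij a\<close> show "\<exists>b\<in>arr perm_groupoid. src perm_groupoid b = rng perm_groupoid a \<and>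
      rng perm_groupoid b = src perm_groupoid a \<and>
      a \<cdot>\<^bsub>perm_groupoid\<^esub> b = rng perm_groupoid a \<and> b \<cdot>\<^bsub>perm_groupoid\<^esub> a = src perm_groupoid a"
    by (intro bexI[of _ "inv a"])
      (auto simp: perm_groupoid_def bij_imp_bij_inv)
qed (auto simp: perm_groupoid_def obj_def bij_comp fun_eq_iff)

text \<open>
  Prepending \<open>e\<close> is injective on lists but not surjective.  The second copy of the lists, on which
  \<open>e\<close> is removed again, extends it to a permutation: lists not starting with \<open>e\<close> cross over.
\<close>

fun shift :: "'x \<Rightarrow> bool \<times> 'x list \<Rightarrow> bool \<times> 'x list" where
  "shift e (True, w) = (True, e # w)"
| "shift e (False, []) = (True, [])"
| "shift e (False, f # w) = (if f = e then (False, w) else (True, f # w))"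

fun unshift :: "'x \<Rightarrow> bool \<times> 'x list \<Rightarrow> bool \<times> 'x list" where
  "unshift e (False, w) = (False, e # w)"
| "unshift e (True, []) = (False, [])"
| "unshift e (True, f # w) = (if f = e then (True, w) else (False, f # w))"

lemma bij_shift: "bij (shift e)"
proof (rule o_bij)
  have "unshift e (shift e z) = z" for z by (induction e z rule: shift.induct) auto
  then show "unshift e \<circ> shift e = id" by (simp add: fun_eq_iff)
  have "shift e (unshift e z) = z" for z by (induction e z rule: unshift.induct) auto
  then show "shift e \<circ> unshift e = id" by (simp add: fun_eq_iff)
qed

text \<open>This is the relation between \<open>t\<close> and the \<open>g\<close>'s, with
  relabelling by \<open>\<sigma>\<close> as \<open>t\<close> and \<open>shift e\<close> as the
  generator of \<open>e\<close>. Injectivity keeps the test \<open>f = e\<close> in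
  \<open>shift\<close> invariant under relabelling.\<close>

lemma map_shift:
  assumes "inj \<sigma>"
  shows "map_prod id (map \<sigma>) (shift e z) = shift (\<sigma> e) (map_prod id (map \<sigma>) z)"
  by (induction e z rule: shift.induct) (use assms in \<open>auto simp: inj_eq\<close>)

definition colour_perm ::
    "('x \<Rightarrow> 'x) \<Rightarrow> nat \<Rightarrow> nat \<times> 'x \<Rightarrow> bool \<times> 'x list \<Rightarrow> bool \<times> 'x list" where
  "colour_perm \<sigma> j a =
     (if fst a < j then map_prod id (map \<sigma>) else if fst a = j then shift (snd a) else id)"

text \<open>The relation reads \<open>(i, e)(l, f) = (l, \<sigma> f)(i, e)\<close>. The images
  commute trivially unless \<open>i < j\<close> and \<open>l = j\<close>, and that case is
  \<open>map_shift\<close>.\<close>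

lemma yb_rep_colour_perm:
  assumes \<sigma>: "bij \<sigma>" "bij_betw \<sigma> X X" and R: "\<And>e f. e \<in> X \<Longrightarrow> f \<in> X \<Longrightarrow> R (e, f) = (\<sigma> f, e)"
  shows "yb_rep perm_groupoid k X R id (colour_perm \<sigma> j)"
proof -
  interpret groupoid perm_groupoid by (rule groupoid_perm_groupoid)
  have "bij (map_prod (id :: bool \<Rightarrow> bool) (map \<sigma>))"
  proof (rule o_bij)
    show "map_prod id (map (inv \<sigma>)) \<circ> map_prod id (map \<sigma>) = id"
      using bij_is_inj[OF \<sigma>(1)] by (simp add: fun_eq_iff)
    show "map_prod id (map \<sigma>) \<circ> map_prod id (map (inv \<sigma>)) = id"
      using bij_is_surj[OF \<sigma>(1)] by (simp add: map_prod.comp surj_iff map_prod.id)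
  qed
  then have arr: "colour_perm \<sigma> j a \<in> arr perm_groupoid" for a
    by (simp add: perm_groupoid_def colour_perm_def bij_shift)
  show ?thesis
  proof
    show "R \<in> X \<times> X \<rightarrow> X \<times> X" using \<sigma>(2) R by (auto simp: bij_betw_def)
    fix i l e f assume "e \<in> X" "f \<in> X" "i < (l :: nat)"
    then show "colour_perm \<sigma> j (i, e) \<cdot>\<^bsub>perm_groupoid\<^esub> colour_perm \<sigma> j (l, f) =
      colour_perm \<sigma> j (l, fst (R (e, f))) \<cdot>\<^bsub>perm_groupoid\<^esub> colour_perm \<sigma> j (i, snd (R (e, f)))"
      using bij_is_inj[OF \<sigma>(1)] R
      by (auto simp: perm_groupoid_def colour_perm_def fun_eq_iff map_shift)
  qed (use arr in \<open>auto simp: obj_perm_groupoid\<close>)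
qed

section \<open>Recovering a word from its colour parts\<close>

text \<open>The rightmost letters act first. Colours below \<open>j\<close> fix
  \<open>(True, [])\<close>, then the edges of colour \<open>j\<close> prepend their labels, and
  larger colours act as the identity; decreasing order ensures that no label is ever changed by
  \<open>\<sigma>\<close>.\<close>

lemma foldr_colour_perm:
  "sorted_wrt (\<ge>) (map fst w) \<Longrightarrow>
    foldr (\<lambda>a. (\<circ>) (colour_perm \<sigma> j a)) w id (True, []) = (True, map snd (filter (\<lambda>a. fst a = j) w))"
proof (induction w)
  case (Cons a w)
  have "filter (\<lambda>a. fst a = j) w = []" if "fst a < j"
    using that Cons.prems by (auto simp: filter_empty_conv)
  then show ?case using Cons by (auto simp: colour_perm_def)
qed simp

text \<open>The colour of each head occurs in the other word, where the head has the largest colour.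
  So the heads have the same colour, and its part yields the same label.\<close>

lemma words_eq_if_filters_eq:
  "\<lbrakk>u \<in> words k X; w \<in> words k X;
    \<And>j. map snd (filter (\<lambda>a. fst a = j) u) = map snd (filter (\<lambda>a. fst a = j) w)\<rbrakk> \<Longrightarrow> u = w"
proof (induction u arbitrary: w)
  case Nil
  show ?case
  proof (cases w)
    case (Cons b w')
    then show ?thesis using Nil.prems(3)[of "fst b"] by simp
  qed simp
next
  case (Cons a u)
  obtain b w' where w: "w = b # w'"
    using Cons.prems(3)[of "fst a"] by (cases w) auto
  have ne: "filter (\<lambda>c. fst c = fst a) w \<noteq> []" "filter (\<lambda>c. fst c = fst b) (a # u) \<noteq> []"
    using Cons.prems(3)[of "fst a"] Cons.prems(3)[of "fst b"] by (auto simp: w split: if_splits)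
  have "fst a \<le> fst b" "fst b \<le> fst a"
    using ne Cons.prems(1,2) by (auto simp: w filter_empty_conv split: if_splits)
  then have ab: "a = b" using Cons.prems(3)[of "fst a"] by (auto simp: w prod_eq_iff)
  have "u = w'"
  proof (rule Cons.IH)
    fix j show "map snd (filter (\<lambda>a. fst a = j) u) = map snd (filter (\<lambda>a. fst a = j) w')"
      using Cons.prems(3)[of j] by (auto simp: w ab split: if_splits)
  qed (use Cons.prems w in auto)
  then show ?case by (simp add: w ab)
qed

text \<open>Functors to groupoids factor through \<open>\<iota>\<close>, so they agree on
  \<open>a\<close> and \<open>b\<close>. Evaluation in \<open>colour_perm \<sigma> j\<close> then
  gives equal parts of colour \<open>j\<close>, for every \<open>j\<close>.\<close>

lemma fundamental_groupoid_inj: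
  assumes perm: "permutation_type X R"
    and yb: "yb_kgraph k X R \<Lambda> \<eta>" and YB: "yang_baxter X R" and P: "fundamental_groupoid \<Lambda> P \<iota>"
  shows "inj_on \<iota> (arr \<Lambda>)"
proof (rule inj_onI)
  fix a b assume ab: "a \<in> arr \<Lambda>" "b \<in> arr \<Lambda>" "\<iota> a = \<iota> b"
  have RX: "R \<in> X \<times> X \<rightarrow> X \<times> X" using YB by (simp add: yang_baxter_def)
  interpret k_graph k \<Lambda> using yb by (simp add: yb_kgraph_def)
  obtain \<phi> where \<phi>: "kgraph_iso (word_kgraph k X R) \<Lambda> \<phi>"
    by (rule kgraph_iso_word_kgraph[OF yb RX])
  let ?\<psi> = "inv_into (words k X) \<phi>"
  have \<psi>: "kgraph_iso \<Lambda> (word_kgraph k X R) ?\<psi>"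
    using kgraph_iso_inverse[OF \<phi> small_category_word_kgraph[OF RX YB]] by simp
  obtain \<sigma>0 where \<sigma>0: "bij_betw \<sigma>0 X X" "\<forall>e \<in> X. \<forall>f \<in> X. R (e, f) = (\<sigma>0 f, e)"
    using perm by (auto simp: permutation_type_def)
  \<comment> \<open>Extension by the identity outside \<open>X\<close> makes \<open>\<sigma>\<close>
    a permutation of the whole type, as needed for relabelling all lists to be a bijection.\<close>
  define \<sigma> where "\<sigma> x = (if x \<in> X then \<sigma>0 x else x)" for x
  have \<sigma>: "bij_betw \<sigma> X X" "\<And>e f. e \<in> X \<Longrightarrow> f \<in> X \<Longrightarrow> R (e, f) = (\<sigma> f, e)"
    using \<sigma>0 by (auto simp: \<sigma>_def cong: bij_betw_cong)
  have "bij_betw \<sigma> (X \<union> - X) (X \<union> - X)"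
    by (rule bij_betw_combine[OF \<sigma>(1)]) (auto simp: \<sigma>_def bij_betw_def inj_on_def)
  then have "bij \<sigma>" by simp
  have words: "?\<psi> a \<in> words k X" "?\<psi> b \<in> words k X"
    using \<psi> ab by (auto simp: kgraph_iso_def is_functor_def)
  have "?\<psi> a = ?\<psi> b"
  proof (rule words_eq_if_filters_eq[OF words])
    fix j
    interpret rep: yb_rep perm_groupoid k X R id "colour_perm \<sigma> j"
      by (rule yb_rep_colour_perm[OF \<open>bij \<sigma>\<close> \<sigma>])
    have "is_functor \<Lambda> perm_groupoid (\<lambda>a. rep.eval (?\<psi> a))"
      by (rule is_functor_comp[OF _ rep.is_functor_eval]) (use \<psi> in \<open>simp add: kgraph_iso_def\<close>)
    \<comment> \<open>The permutation groupoid lives on a type other than the one in the definition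
      of \<open>fundamental_groupoid\<close>, so the universal property for arbitrary types is
      used.\<close>
    from fundamental_groupoid_universal[OF small_category_axioms P groupoid_perm_groupoid this]
    obtain H where "\<forall>a \<in> arr \<Lambda>. H (\<iota> a) = rep.eval (?\<psi> a)" by (elim ex1E conjE)
    then have "rep.eval (?\<psi> a) = rep.eval (?\<psi> b)" using ab by metis
    moreover have "rep.eval w (True, []) = (True, map snd (filter (\<lambda>a. fst a = j) w))"
      if "w \<in> words k X" for w
      using that foldr_colour_perm[of w \<sigma> j] unfolding rep.eval_def
      by (simp add: perm_groupoid_def words_def)
    ultimately show "map snd (filter (\<lambda>a. fst a = j) (?\<psi> a)) = map snd (filter (\<lambda>a. fst a = j) (?\<psi> b))"
      using words by (metis prod.inject)
  qed
  then show "a = b"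
    using \<psi> ab by (auto simp: kgraph_iso_def bij_betw_def inj_on_def)
qed

text \<open>Bijectivity of \<open>R\<close> is a condition for existence because unique
  factorisation makes every \<open>(j, f')(i, e')\<close> with \<open>i < j\<close> equal to exactly
  one \<open>(i, e)(j, f)\<close>. Uniqueness means an isomorphism that respects the edge
  labels.\<close>

theorem lemma3p22:
  fixes X :: "'x set" and R :: "'x \<times> 'x \<Rightarrow> 'x \<times> 'x" and k :: nat
  assumes "finite X" and "X \<noteq> {}" and "yang_baxter X R" and "k \<ge> 2"
  shows "(bij_betw R (X \<times> X) (X \<times> X) \<longrightarrow>
            (\<exists>(\<Lambda> :: (nat \<times> 'x) list kgraph) \<eta>. yb_kgraph k X R \<Lambda> \<eta>)) \<and>
         (\<forall>(\<Lambda> :: 'a kgraph) \<eta> (\<Lambda>' :: 'b kgraph) \<eta>'.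
            yb_kgraph k X R \<Lambda> \<eta> \<and> yb_kgraph k X R \<Lambda>' \<eta>' \<longrightarrow>
            (\<exists>\<phi>. kgraph_iso \<Lambda> \<Lambda>' \<phi> \<and> (\<forall>i \<in> {1..k}. \<forall>e \<in> X. \<phi> (\<eta> (i, e)) = \<eta>' (i, e)))) \<and>
         (permutation_type X R \<longrightarrow>
            (\<forall>(\<Lambda> :: 'a kgraph) \<eta> (P :: 'p category) \<iota>.
               yb_kgraph k X R \<Lambda> \<eta> \<and> fundamental_groupoid \<Lambda> P \<iota> \<longrightarrow> inj_on \<iota> (arr \<Lambda>)))"
proof (intro conjI impI allI; (elim conjE)?)
  assume "bij_betw R (X \<times> X) (X \<times> X)"
  then show "\<exists>(\<Lambda> :: (nat \<times> 'x) list kgraph) \<eta>. yb_kgraph k X R \<Lambda> \<eta>"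
    using yb_kgraph_word_kgraph assms(3) by blast
next
  fix \<Lambda> :: "'a kgraph" and \<eta> and \<Lambda>' :: "'b kgraph" and \<eta>'
  assume yb: "yb_kgraph k X R \<Lambda> \<eta>" and yb': "yb_kgraph k X R \<Lambda>' \<eta>'"
  have RX: "R \<in> X \<times> X \<rightarrow> X \<times> X" using assms(3) by (simp add: yang_baxter_def)
  \<comment> \<open>The isomorphism passes through the word model, where both labellings come from
    the words \<open>[(i, e)]\<close>.\<close>
  let ?W = "word_kgraph k X R"
  have W: "small_category ?W" by (rule small_category_word_kgraph[OF RX assms(3)])
  obtain \<phi> where \<phi>: "kgraph_iso ?W \<Lambda> \<phi>" "\<forall>i \<in> {1..k}. \<forall>e \<in> X. \<phi> [(i, e)] = \<eta> (i, e)"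
    by (rule kgraph_iso_word_kgraph[OF yb RX])
  obtain \<psi> where \<psi>: "kgraph_iso ?W \<Lambda>' \<psi>" "\<forall>i \<in> {1..k}. \<forall>e \<in> X. \<psi> [(i, e)] = \<eta>' (i, e)"
    by (rule kgraph_iso_word_kgraph[OF yb' RX])
  have "inv_into (words k X) \<phi> (\<eta> (i, e)) = [(i, e)]" if "i \<in> {1..k}" "e \<in> X" for i e
  proof -
    have "inj_on \<phi> (words k X)" using \<phi>(1) by (simp add: kgraph_iso_def bij_betw_def)
    from inv_into_f_f[OF this, of "[(i, e)]"] show ?thesis using \<phi>(2) that by simp
  qed
  then show "\<exists>\<phi>. kgraph_iso \<Lambda> \<Lambda>' \<phi> \<and> (\<forall>i \<in> {1..k}. \<forall>e \<in> X. \<phi> (\<eta> (i, e)) = \<eta>' (i, e))"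
    using kgraph_iso_comp[OF kgraph_iso_inverse[OF \<phi>(1) W] \<psi>(1)] \<psi>(2)
    by (intro exI[of _ "\<lambda>a. \<psi> (inv_into (words k X) \<phi> a)"]) auto
next
  fix \<Lambda> :: "'a kgraph" and \<eta> and P :: "'p category" and \<iota>
  assume "permutation_type X R" "yb_kgraph k X R \<Lambda> \<eta>" "fundamental_groupoid \<Lambda> P \<iota>"
  then show "inj_on \<iota> (arr \<Lambda>)" using fundamental_groupoid_inj assms(3) by blast
qed

end
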